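(* Let $w:[0,1]^2\to[0,1]$ be a graphon and let $\mu_w$ be the probability measure on $\mathbb R$ whose odd moments vanish and such that, for every integer $p\ge1$, $$\int x^{2p}\,\mathrm d\mu_w=\sum_{\pi\in P_2(2p)}\rho(f_\pi,w).$$ Let $q:=\sup_{(x,y)\in[0,1]^2}w(x,y)$, and let $\mu_q$ be the $q$-Gaussian law. Then, for all integers $p\ge1$, $$\int x^p\,\mathrm d\mu_w\le\int x^p\,\mathrm d\mu_q.$$ In particular, if $q<1$, then $\mu_w$ has bounded support, and its support is contained in $\left[-\frac{2}{\sqrt{1-q}},\frac{2}{\sqrt{1-q}}\right]$.
   Context: A graphon is a measurable symmetric function $w:[0,1]^2\to[0,1]$. For a finite simple graph $f=(V(f),E(f))$, $\rho(f,w)=\int_{[0,1]^{V(f)}}\prod_{(u,v)\in E(f)}w(x_u,x_v)\,\mathrm dx$ (each edge counted once). $P_2(2p)$ is the set of pair partitions of $[2p]$. Two blocks of a partition cross if there are $i<k<j<l$ with $\{i,j\}$ contained in one of them and $\{k,l\}$ in the other. The intersection graph $f_\pi$ of $\pi$ has the blocks of $\pi$ as vertices, with an edge between two distinct blocks iff they cross. For $q\in[0,1]$, the $q$-Gaussian law $\mu_q$ is the probability measure on $\mathbb R$ whose odd moments vanish and whose $2p$-th moment is $\sum_{\pi\in P_2(2p)}q^{|E(f_\pi)|}$ (with $0^0=1$). *)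

theory Defs
  imports "HOL-Probability.Probability"
begin

text \<open>
  Functions on the unit square are total functions on the plane; only their values on
  the unit square matter. Measurability is meant in the sense of Lebesgue, which covers
  Borel measurable functions.
\<close>

definition graphon :: "(real \<Rightarrow> real \<Rightarrow> real) \<Rightarrow> bool" where
  "graphon w \<longleftrightarrow>
     (\<lambda>(x, y). w x y) \<in> borel_measurable (lebesgue_on ({0..1} \<times> {0..1})) \<and>
     (\<forall>x\<in>{0..1}. \<forall>y\<in>{0..1}. w x y = w y x) \<and>
     (\<forall>x\<in>{0..1}. \<forall>y\<in>{0..1}. 0 \<le> w x y \<and> w x y \<le> 1)"

text \<open>
  A graph is given by its vertex set and its set of edges, an edge being a set of two
  distinct vertices. The weight of an edge does not depend on the order of its two ends
  because a graphon is symmetric.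
\<close>

definition edge_weight :: "(real \<Rightarrow> real \<Rightarrow> real) \<Rightarrow> ('a \<Rightarrow> real) \<Rightarrow> 'a set \<Rightarrow> real" where
  "edge_weight w x e = (THE r. \<exists>u v. e = {u, v} \<and> u \<noteq> v \<and> r = w (x u) (x v))"

text \<open>
  The product measure is completed because for a Lebesgue measurable \<open>w\<close> the map
  taking \<open>x\<close> to \<open>w (x u) (x v)\<close> need not be measurable for the product sigma-algebra itself.
\<close>

definition hom_density :: "'a set \<Rightarrow> 'a set set \<Rightarrow> (real \<Rightarrow> real \<Rightarrow> real) \<Rightarrow> real" where
  "hom_density V E w =
     (\<integral>x. (\<Prod>e\<in>E. edge_weight w x e) \<partial>completion (\<Pi>\<^sub>M v\<in>V. lebesgue_on {0..1}))"

definition pair_partitions :: "nat \<Rightarrow> nat set set set" where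
  "pair_partitions n = {\<pi>. partition_on {1..n} \<pi> \<and> (\<forall>B\<in>\<pi>. card B = 2)}"

definition crossing :: "nat set \<Rightarrow> nat set \<Rightarrow> bool" where
  "crossing B C \<longleftrightarrow>
     (\<exists>i k j l. i < k \<and> k < j \<and> j < l \<and>
        ({i, j} \<subseteq> B \<and> {k, l} \<subseteq> C \<or> {i, j} \<subseteq> C \<and> {k, l} \<subseteq> B))"

text \<open>The vertex set of the intersection graph of \<open>\<pi>\<close> is \<open>\<pi>\<close> itself.\<close>

definition intersection_edges :: "nat set set \<Rightarrow> nat set set set" where
  "intersection_edges \<pi> = {{B, C} | B C. B \<in> \<pi> \<and> C \<in> \<pi> \<and> B \<noteq> C \<and> crossing B C}"

text \<open>
  A probability measure on the real line all of whose moments exist, whose odd moments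
  vanish and whose moment of order \<open>2 * p\<close> is \<open>m p\<close> for \<open>p \<ge> 1\<close>.
\<close>

definition law_with_even_moments :: "(nat \<Rightarrow> real) \<Rightarrow> real measure \<Rightarrow> bool" where
  "law_with_even_moments m M \<longleftrightarrow>
     real_distribution M \<and>
     (\<forall>n. integrable M (\<lambda>x. x ^ n)) \<and>
     (\<forall>n. odd n \<longrightarrow> (\<integral>x. x ^ n \<partial>M) = 0) \<and>
     (\<forall>p\<ge>1. (\<integral>x. x ^ (2 * p) \<partial>M) = m p)"

definition graphon_law :: "(real \<Rightarrow> real \<Rightarrow> real) \<Rightarrow> real measure \<Rightarrow> bool" where
  "graphon_law w =
     law_with_even_moments
       (\<lambda>p. \<Sum>\<pi>\<in>pair_partitions (2 * p). hom_density \<pi> (intersection_edges \<pi>) w)"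

definition q_gaussian_law :: "real \<Rightarrow> real measure \<Rightarrow> bool" where
  "q_gaussian_law q =
     law_with_even_moments
       (\<lambda>p. \<Sum>\<pi>\<in>pair_partitions (2 * p). q ^ card (intersection_edges \<pi>))"

text \<open>
  The (closed) topological support: the points all of whose open neighbourhoods have
  positive measure.
\<close>

definition measure_support :: "'a::topological_space measure \<Rightarrow> 'a set" where
  "measure_support M = {x. \<forall>U. open U \<longrightarrow> x \<in> U \<longrightarrow> emeasure M U > 0}"

end

(* A graphon bounded by q gives rho(f, w) <= q^|E(f)|, which yields the comparison of moments.
   For the support it then suffices that the sum of q^|E(f_pi)| over the pair partitions of [n] is
   at most (2 / sqrt (1 - q))^n, by Markov's inequality. Read a pair partition from left to right
   and record, at each right endpoint of an arc, the number of still open arcs which that arc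
   crosses. This code determines the partition, and the recorded numbers add up to the number of
   crossings. Give a left endpoint the weight s and a right endpoint recording d the weight q^d / s;
   then the sum is at most (s + 1 / (s (1 - q)))^n, and s = 1 / sqrt (1 - q) is the best choice. *)
theory Submission
  imports Defs
begin

section \<open>Homomorphism densities\<close>

text \<open>Symmetry of \<open>w\<close> makes both orderings of the two ends give the same value,
  so the definite description is well defined.\<close>

lemma edge_weight_pair:
  assumes "graphon w" "x u \<in> {0..1}" "x v \<in> {0..1}" "u \<noteq> v"
  shows "edge_weight w x {u, v} = w (x u) (x v)"
  unfolding edge_weight_def
proof (rule the_equality)
  show "\<exists>u' v'. {u, v} = {u', v'} \<and> u' \<noteq> v' \<and> w (x u) (x v) = w (x u') (x v')"
    using assms(4) by blast
next
  fix r
  assume "\<exists>u' v'. {u, v} = {u', v'} \<and> u' \<noteq> v' \<and> r = w (x u') (x v')"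
  moreover have "w (x u) (x v) = w (x v) (x u)"
    using assms unfolding graphon_def by blast
  ultimately show "r = w (x u) (x v)"
    by (auto simp: doubleton_eq_iff)
qed

text \<open>Every edge contributes a factor in [0, \<open>q\<close>], and the integral is over a
  probability space.\<close>

lemma hom_density_le_power:
  assumes w: "graphon w"
    and q: "\<And>x y. x \<in> {0..1} \<Longrightarrow> y \<in> {0..1} \<Longrightarrow> w x y \<le> q" "0 \<le> q"
    and E: "\<And>e. e \<in> E \<Longrightarrow> \<exists>u\<in>V. \<exists>v\<in>V. e = {u, v} \<and> u \<noteq> v"
  shows "hom_density V E w \<le> q ^ card E"
proof -
  let ?M = "\<Pi>\<^sub>M v\<in>V. lebesgue_on {0..1::real}"
  interpret prob_space ?M
    by (intro prob_space_PiM prob_spaceI) (simp add: emeasure_restrict_space)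
  have emeasure_1: "emeasure (completion ?M) (space (completion ?M)) = 1"
    using emeasure_space_1 by simp
  have edge: "0 \<le> edge_weight w x e \<and> edge_weight w x e \<le> q"
    if "x \<in> space (completion ?M)" "e \<in> E" for x e
  proof -
    obtain u v where uv: "u \<in> V" "v \<in> V" "e = {u, v}" "u \<noteq> v"
      using E \<open>e \<in> E\<close> by blast
    have x: "x u \<in> {0..1}" "x v \<in> {0..1}"
      using that(1) uv by (auto simp: space_PiM PiE_iff)
    then have "edge_weight w x e = w (x u) (x v)"
      using w uv by (simp add: edge_weight_pair)
    moreover have "0 \<le> w (x u) (x v)"
      using w x unfolding graphon_def by blast
    ultimately show ?thesis
      using q(1) x by simp
  qed
  have "hom_density V E w \<le> (\<integral>x. q ^ card E \<partial>completion ?M)"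
    unfolding hom_density_def
  \<comment> \<open>Integrability is asked of the constant bound only: a product that failed to be
    integrable would have integral 0 by convention, which is at most
    \<open>q ^ card E\<close>.\<close>
  proof (rule integral_mono')
    show "integrable (completion ?M) (\<lambda>x. q ^ card E)"
      using prob_spaceI[OF emeasure_1]
      by (intro finite_measure.integrable_const prob_space.finite_measure)
    fix x assume "x \<in> space (completion ?M)"
    then have "(\<Prod>e\<in>E. edge_weight w x e) \<le> (\<Prod>e\<in>E. q)"
      using edge by (intro prod_mono) auto
    then show "(\<Prod>e\<in>E. edge_weight w x e) \<le> q ^ card E"
      by simp
  qed (use q in simp)
  also have "\<dots> = q ^ card E"
    using emeasure_1 by (simp add: measure_def)
  finally show ?thesis .
qed

section \<open>Coding pair partitions\<close>

lemma pair_partitions_Union: "\<pi> \<in> pair_partitions n \<Longrightarrow> \<Union>\<pi> = {1..n}"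
  by (auto simp: pair_partitions_def partition_on_def)

lemma finite_pair_partition: "\<pi> \<in> pair_partitions n \<Longrightarrow> finite \<pi>"
  by (metis pair_partitions_Union finite_UnionD finite_atLeastAtMost)

lemma pair_partitions_unique:
  "\<pi> \<in> pair_partitions n \<Longrightarrow> B \<in> \<pi> \<Longrightarrow> C \<in> \<pi> \<Longrightarrow> x \<in> B \<Longrightarrow> x \<in> C \<Longrightarrow> B = C"
  by (auto simp: pair_partitions_def partition_on_def disjoint_def)

lemma pair_partitions_block:
  assumes "\<pi> \<in> pair_partitions n" "B \<in> \<pi>"
  shows "B = {Min B, Max B}" "Min B < Max B" "finite B" "Min B \<in> B" "Max B \<in> B"
proof -
  have "card B = 2"
    using assms by (simp add: pair_partitions_def)
  then obtain x y where xy: "B = {x, y}" "x \<noteq> y"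
    by (auto simp: card_2_iff)
  then show "B = {Min B, Max B}" "Min B < Max B" "finite B" "Min B \<in> B" "Max B \<in> B"
    by (auto simp: min_def max_def)
qed

text \<open>A crossing is charged to the block that closes first, so that it is counted
  once.\<close>

definition crossed_blocks :: "nat set set \<Rightarrow> nat set \<Rightarrow> nat set set" where
  "crossed_blocks \<pi> B = {C \<in> \<pi>. Min B < Min C \<and> Min C < Max B \<and> Max B < Max C}"

text \<open>The sum has at most one term: it is empty exactly when \<open>j\<close> is a left endpoint.\<close>

definition arc_code :: "nat \<Rightarrow> nat set set \<Rightarrow> nat \<Rightarrow> nat" where
  "arc_code n \<pi> = (\<lambda>j\<in>{1..n}. \<Sum>B | B \<in> \<pi> \<and> Max B = j. Suc (card (crossed_blocks \<pi> B)))"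

text \<open>Blocks are disjoint, so only \<open>B\<close> contributes to the sum. The
  \<open>Suc\<close> distinguishes a right endpoint that records 0 from a left endpoint.\<close>

lemma arc_code_Max:
  assumes "\<pi> \<in> pair_partitions n" "B \<in> \<pi>"
  shows "arc_code n \<pi> (Max B) = Suc (card (crossed_blocks \<pi> B))"
proof -
  have "C = B" if "C \<in> \<pi>" "Max C = Max B" for C
    using pair_partitions_unique[OF assms(1) that(1) assms(2), of "Max B"] that(2)
      pair_partitions_block(5)[OF assms] pair_partitions_block(5)[OF assms(1) that(1)] by simp
  then have "{C. C \<in> \<pi> \<and> Max C = Max B} = {B}"
    using assms(2) by blast
  moreover have "Max B \<in> {1..n}"
    using assms pair_partitions_block(5) pair_partitions_Union by blast
  ultimately show ?thesis
    by (simp add: arc_code_def)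
qed

lemma arc_code_Min:
  assumes "\<pi> \<in> pair_partitions n" "B \<in> \<pi>"
  shows "arc_code n \<pi> (Min B) = 0"
proof -
  have "Max C \<noteq> Min B" if "C \<in> \<pi>" for C
  proof
    assume C: "Max C = Min B"
    then have "C = B"
      using pair_partitions_unique[OF assms(1) that assms(2), of "Min B"]
        pair_partitions_block(4)[OF assms] pair_partitions_block(5)[OF assms(1) that] by simp
    then show False
      using C pair_partitions_block(2)[OF assms] by simp
  qed
  then have "{C. C \<in> \<pi> \<and> Max C = Min B} = {}"
    by blast
  moreover have "Min B \<in> {1..n}"
    using assms pair_partitions_block(4) pair_partitions_Union by blast
  ultimately show ?thesis
    by (simp only: arc_code_def restrict_apply' sum.empty)
qed

lemma arc_code_nonzero:
  assumes "arc_code n \<pi> j \<noteq> 0" "j \<in> {1..n}"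
  shows "\<exists>B\<in>\<pi>. Max B = j"
proof (rule ccontr)
  assume "\<not> (\<exists>B\<in>\<pi>. Max B = j)"
  then have "{B. B \<in> \<pi> \<and> Max B = j} = {}"
    by blast
  then show False
    using assms by (simp only: arc_code_def restrict_apply' sum.empty simp_thms)
qed

text \<open>A crude bound, counting all subsets of \<open>{1..n}\<close>; it serves to place the
  codes in a finite set of functions.\<close>

lemma arc_code_le:
  assumes "\<pi> \<in> pair_partitions n" "j \<in> {1..n}"
  shows "arc_code n \<pi> j \<le> Suc (2 ^ n)"
proof (cases "arc_code n \<pi> j = 0")
  case False
  then obtain B where B: "B \<in> \<pi>" "Max B = j"
    using arc_code_nonzero assms by blast
  have "crossed_blocks \<pi> B \<subseteq> Pow {1..n}"
    using pair_partitions_Union[OF assms(1)] by (auto simp: crossed_blocks_def)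
  then have "card (crossed_blocks \<pi> B) \<le> card (Pow {1..n})"
    by (intro card_mono) auto
  then show ?thesis
    using arc_code_Max[OF assms(1) B(1)] B(2) by (simp add: card_Pow)
qed simp

text \<open>For a pair partition these are the left endpoints of the arcs still open just before
  \<open>j\<close>. The condition only excludes points of blocks closed before \<open>j\<close>, so
  the set depends on those blocks alone.\<close>

definition open_points :: "nat \<Rightarrow> nat set set \<Rightarrow> nat \<Rightarrow> nat set" where
  "open_points n \<pi> j = {k\<in>{1..n}. k < j \<and> (\<forall>C\<in>\<pi>. k \<in> C \<longrightarrow> j \<le> Max C)}"

lemma Min_in_open_points:
  assumes "\<pi> \<in> pair_partitions n" "B \<in> \<pi>"
  shows "Min B \<in> open_points n \<pi> (Max B)"
proof -
  have "Min B \<in> {1..n}"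
    using assms pair_partitions_block(4) pair_partitions_Union by blast
  moreover have "Max B \<le> Max C" if "C \<in> \<pi>" "Min B \<in> C" for C
    using pair_partitions_unique[OF assms(1) that(1) assms(2) that(2)]
      pair_partitions_block(4)[OF assms] by simp
  ultimately show ?thesis
    using pair_partitions_block(2)[OF assms] by (auto simp: open_points_def)
qed

text \<open>\<open>Min\<close> maps the crossed blocks bijectively onto the open points to the right
  of \<open>Min B\<close>.\<close>

lemma card_crossed_blocks:
  assumes \<pi>: "\<pi> \<in> pair_partitions n" and B: "B \<in> \<pi>"
  shows "card (crossed_blocks \<pi> B) = card {k \<in> open_points n \<pi> (Max B). Min B < k}"
proof -
  have "Min ` crossed_blocks \<pi> B = {k \<in> open_points n \<pi> (Max B). Min B < k}"
  proof (intro equalityI subsetI)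
    fix k assume "k \<in> Min ` crossed_blocks \<pi> B"
    then obtain C where C: "C \<in> \<pi>" "k = Min C" "Min B < Min C" "Min C < Max B" "Max B < Max C"
      by (auto simp: crossed_blocks_def)
    then have "k \<in> C"
      using pair_partitions_block(4)[OF \<pi> C(1)] by simp
    then have "k \<in> {1..n}"
      using C(1) pair_partitions_Union[OF \<pi>] by blast
    moreover have "Max B \<le> Max D" if "D \<in> \<pi>" "k \<in> D" for D
      using pair_partitions_unique[OF \<pi> that(1) C(1) that(2) \<open>k \<in> C\<close>] C(5) by simp
    ultimately show "k \<in> {k \<in> open_points n \<pi> (Max B). Min B < k}"
      using C(2-4) unfolding open_points_def by simp
  next
    fix k assume k: "k \<in> {k \<in> open_points n \<pi> (Max B). Min B < k}"
    then obtain C where C: "C \<in> \<pi>" "k \<in> C"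
      using pair_partitions_Union[OF \<pi>] unfolding open_points_def by blast
    have "Max B \<le> Max C" "k < Max B" "Min B < k"
      using k C by (auto simp: open_points_def)
    moreover have "k = Min C \<or> k = Max C"
      using C(2) pair_partitions_block(1)[OF \<pi> C(1)] by blast
    moreover from calculation have "k = Min C"
      by linarith
    \<comment> \<open>The arc closing at \<open>Max B\<close> also counts as open there, but its
      left endpoint is \<open>Min B\<close>, which lies strictly before \<open>k\<close>.\<close>
    moreover have "Max C \<noteq> Max B"
    proof
      assume "Max C = Max B"
      then have "C = B"
        using pair_partitions_unique[OF \<pi> C(1) B, of "Max B"]
          pair_partitions_block(5)[OF \<pi> B] pair_partitions_block(5)[OF \<pi> C(1)] by simp
      then show False
        using \<open>k = Min C\<close> \<open>Min B < k\<close> by simp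
    qed
    ultimately show "k \<in> Min ` crossed_blocks \<pi> B"
      using C by (auto simp: crossed_blocks_def)
  qed
  moreover have "inj_on Min (crossed_blocks \<pi> B)"
  proof (rule inj_onI)
    fix C D assume CD: "C \<in> crossed_blocks \<pi> B" "D \<in> crossed_blocks \<pi> B" "Min C = Min D"
    then have "C \<in> \<pi>" "D \<in> \<pi>"
      by (auto simp: crossed_blocks_def)
    then show "C = D"
      using pair_partitions_unique[OF \<pi>] pair_partitions_block(4)[OF \<pi>] CD(3) by metis
  qed
  ultimately show ?thesis
    by (metis card_image)
qed

text \<open>The number of larger elements is the rank from above. It lets the code single out one
  open point.\<close>

lemma card_greater_inj:
  fixes A :: "'a::linorder set"
  assumes "finite A" "a \<in> A" "b \<in> A" "card {k\<in>A. a < k} = card {k\<in>A. b < k}"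
  shows "a = b"
proof -
  have less: "card {k\<in>A. y < k} < card {k\<in>A. x < k}" if "x < y" "y \<in> A" for x y
    using that assms(1) by (intro psubset_card_mono) auto
  show ?thesis
    using less[of a b] less[of b a] assms(2-4) by (metis less_irrefl linorder_cases)
qed

text \<open>
  The blocks closed before \<open>j\<close> determine the open points at \<open>j\<close>, and the code at \<open>j\<close>
  picks out the one to which \<open>j\<close> is joined.
\<close>

lemma block_mem_if_arc_code_eq:
  assumes \<pi>: "\<pi> \<in> pair_partitions n" and \<sigma>: "\<sigma> \<in> pair_partitions n"
    and code: "arc_code n \<pi> = arc_code n \<sigma>"
    and closed: "\<And>C. Max C < Max B \<Longrightarrow> C \<in> \<pi> \<longleftrightarrow> C \<in> \<sigma>"
    and B: "B \<in> \<pi>"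
  shows "B \<in> \<sigma>"
proof -
  have "Max B \<in> {1..n}"
    using \<pi> B pair_partitions_block(5) pair_partitions_Union by blast
  moreover have "arc_code n \<sigma> (Max B) = Suc (card (crossed_blocks \<pi> B))"
    using arc_code_Max[OF \<pi> B] code by simp
  \<comment> \<open>A nonzero code marks a right endpoint, so some block of \<sigma> closes at the
    same point as \<open>B\<close>. It remains to match the left endpoints.\<close>
  ultimately obtain C where C: "C \<in> \<sigma>" "Max C = Max B"
    using arc_code_nonzero[of n \<sigma> "Max B"] by auto
  then have card: "card (crossed_blocks \<pi> B) = card (crossed_blocks \<sigma> C)"
    using arc_code_Max[OF \<pi> B] arc_code_Max[OF \<sigma> C(1)] code by simp
  have "open_points n \<pi> (Max B) = open_points n \<sigma> (Max B)"
    unfolding open_points_def using closed by (meson not_le)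
  then have "card {k \<in> open_points n \<pi> (Max B). Min B < k}
      = card {k \<in> open_points n \<pi> (Max B). Min C < k}"
    and "Min C \<in> open_points n \<pi> (Max B)"
    using card card_crossed_blocks[OF \<pi> B] card_crossed_blocks[OF \<sigma> C(1)]
      Min_in_open_points[OF \<sigma> C(1)] C(2) by simp_all
  moreover have "finite (open_points n \<pi> (Max B))"
    by (simp add: open_points_def)
  ultimately have "Min B = Min C"
    using card_greater_inj Min_in_open_points[OF \<pi> B] by blast
  then have "B = C"
    using pair_partitions_block(1)[OF \<pi> B] pair_partitions_block(1)[OF \<sigma> C(1)] C(2)
    by metis
  then show ?thesis
    using C(1) by simp
qed

text \<open>Strong induction on the right endpoint: partitions with equal codes that share all
  blocks closed before \<open>j\<close> also share those closed at \<open>j\<close>.\<close>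

lemma inj_on_arc_code: "inj_on (arc_code n) (pair_partitions n)"
proof (rule inj_onI)
  fix \<pi> \<sigma>
  assume *: "\<pi> \<in> pair_partitions n" "\<sigma> \<in> pair_partitions n" "arc_code n \<pi> = arc_code n \<sigma>"
  have "\<forall>B. Max B = j \<longrightarrow> B \<in> \<pi> \<longleftrightarrow> B \<in> \<sigma>" for j
  proof (induction j rule: less_induct)
    case (less j)
    then show ?case
      using block_mem_if_arc_code_eq[OF *] block_mem_if_arc_code_eq[OF *(2,1) *(3)[symmetric]]
      by metis
  qed
  then show "\<pi> = \<sigma>"
    by blast
qed

section \<open>Counting crossings\<close>

text \<open>The pair (\<open>B\<close>, \<open>C\<close>) is sent to the edge \<open>{B, C}\<close>;
  the order is recovered from which block closes first. An upper bound on the recorded sum is the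
  direction that suits 0 \<le> q < 1, where powers of \<open>q\<close> decrease.\<close>

lemma sum_card_crossed_blocks_le:
  assumes \<pi>: "\<pi> \<in> pair_partitions n"
  shows "(\<Sum>B\<in>\<pi>. card (crossed_blocks \<pi> B)) \<le> card (intersection_edges \<pi>)"
proof -
  let ?f = "\<lambda>(B, C). {B, C}"
  have "inj_on ?f (SIGMA B:\<pi>. crossed_blocks \<pi> B)"
    by (auto simp: inj_on_def crossed_blocks_def doubleton_eq_iff)
  moreover have "?f ` (SIGMA B:\<pi>. crossed_blocks \<pi> B) \<subseteq> intersection_edges \<pi>"
  proof clarify
    fix B C assume B: "B \<in> \<pi>" and "C \<in> crossed_blocks \<pi> B"
    then have C: "C \<in> \<pi>" "Min B < Min C" "Min C < Max B" "Max B < Max C"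
      by (auto simp: crossed_blocks_def)
    then have "crossing B C"
      using pair_partitions_block[OF \<pi> B] pair_partitions_block[OF \<pi> C(1)]
      unfolding crossing_def by (metis empty_subsetI insert_subset)
    then show "{B, C} \<in> intersection_edges \<pi>"
      using B C unfolding intersection_edges_def by blast
  qed
  moreover have "finite (intersection_edges \<pi>)"
    using finite_pair_partition[OF \<pi>]
    by (intro finite_subset[of "intersection_edges \<pi>" "Pow \<pi>"]) (auto simp: intersection_edges_def)
  ultimately have "card (SIGMA B:\<pi>. crossed_blocks \<pi> B) \<le> card (intersection_edges \<pi>)"
    by (rule card_inj_on_le)
  then show ?thesis
    using finite_pair_partition[OF \<pi>] by (simp add: crossed_blocks_def)
qed

lemma sum_power_intersection_edges_le:
  assumes q: "0 \<le> q" "q < (1::real)"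
  shows "(\<Sum>\<pi>\<in>pair_partitions n. q ^ card (intersection_edges \<pi>)) \<le> (2 / sqrt (1 - q)) ^ n"
proof -
  define s where "s = 1 / sqrt (1 - q)"
  have s: "s > 0" "s * s = 1 / (1 - q)"
    using q by (auto simp: s_def)
  define g where "g m = (case m of 0 \<Rightarrow> s | Suc d \<Rightarrow> q ^ d / s)" for m
  have g_nonneg: "0 \<le> g m" for m
    using s q by (auto simp: g_def split: nat.split)
  have weight: "q ^ card (intersection_edges \<pi>) \<le> (\<Prod>j\<in>{1..n}. g (arc_code n \<pi> j))"
    if \<pi>: "\<pi> \<in> pair_partitions n" for \<pi>
  proof -
    have "q ^ card (intersection_edges \<pi>) \<le> q ^ (\<Sum>B\<in>\<pi>. card (crossed_blocks \<pi> B))"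
      using q sum_card_crossed_blocks_le[OF \<pi>] by (intro power_decreasing) auto
    also have "\<dots> = (\<Prod>B\<in>\<pi>. q ^ card (crossed_blocks \<pi> B))"
      by (rule power_sum)
    \<comment> \<open>The factors \<open>s\<close> and \<open>1 / s\<close> at the two ends of an
      arc cancel.\<close>
    also have "\<dots> = (\<Prod>B\<in>\<pi>. \<Prod>j\<in>B. g (arc_code n \<pi> j))"
    proof (rule prod.cong)
      fix B assume B: "B \<in> \<pi>"
      have "(\<Prod>j\<in>B. g (arc_code n \<pi> j)) = (\<Prod>j\<in>{Min B, Max B}. g (arc_code n \<pi> j))"
        using pair_partitions_block(1)[OF \<pi> B] by simp
      also have "\<dots> = g (arc_code n \<pi> (Min B)) * g (arc_code n \<pi> (Max B))"
        using pair_partitions_block(2)[OF \<pi> B] by simp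
      also have "\<dots> = q ^ card (crossed_blocks \<pi> B)"
        using s arc_code_Min[OF \<pi> B] arc_code_Max[OF \<pi> B] by (simp add: g_def)
      finally show "q ^ card (crossed_blocks \<pi> B) = (\<Prod>j\<in>B. g (arc_code n \<pi> j))" ..
    qed simp
    also have "\<dots> = (\<Prod>j\<in>\<Union>\<pi>. g (arc_code n \<pi> j))"
      using pair_partitions_block(3)[OF \<pi>] pair_partitions_unique[OF \<pi>]
      by (subst prod.Union_disjoint) auto
    finally show ?thesis
      by (simp add: pair_partitions_Union[OF \<pi>])
  qed
  let ?F = "PiE {1..n} (\<lambda>_. {..Suc (2 ^ n)})"
  have "(\<Sum>\<pi>\<in>pair_partitions n. q ^ card (intersection_edges \<pi>))
      \<le> (\<Sum>\<pi>\<in>pair_partitions n. \<Prod>j\<in>{1..n}. g (arc_code n \<pi> j))"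
    by (intro sum_mono weight)
  also have "\<dots> = (\<Sum>f\<in>arc_code n ` pair_partitions n. \<Prod>j\<in>{1..n}. g (f j))"
    by (simp add: sum.reindex[OF inj_on_arc_code])
  \<comment> \<open>Admitting functions that code no partition only adds nonnegative terms, and the
    sum over all of \<open>?F\<close> factors over the points.\<close>
  also have "\<dots> \<le> (\<Sum>f\<in>?F. \<Prod>j\<in>{1..n}. g (f j))"
  proof (rule sum_mono2)
    have "arc_code n \<pi> \<in> ?F" if "\<pi> \<in> pair_partitions n" for \<pi>
      using arc_code_le[OF that] by (auto simp: PiE_iff arc_code_def)
    then show "arc_code n ` pair_partitions n \<subseteq> ?F"
      by blast
  qed (auto intro!: finite_PiE prod_nonneg g_nonneg)
  also have "\<dots> = (\<Sum>m\<le>Suc (2 ^ n). g m) ^ n"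
    by (subst prod_sum_PiE[symmetric]) (simp_all del: sum.atMost_Suc)
  also have "\<dots> \<le> (2 * s) ^ n"
  proof (rule power_mono)
    have "(\<Sum>m\<le>Suc (2 ^ n). g m) = s + (\<Sum>d\<le>2 ^ n. q ^ d) / s"
      by (subst sum.atMost_Suc_shift) (simp add: g_def sum_divide_distrib)
    \<comment> \<open>The full geometric series removes the dependence on the crude bound for the
      code.\<close>
    also have "(\<Sum>d\<le>2 ^ n. q ^ d) \<le> 1 / (1 - q)"
      using q sum_le_suminf[of "\<lambda>d. q ^ d" "{..2 ^ n}"] by (simp add: suminf_geometric)
    also have "1 / (1 - q) / s = s"
      using s by (metis nonzero_mult_div_cancel_right less_irrefl)
    finally show "(\<Sum>m\<le>Suc (2 ^ n). g m) \<le> 2 * s"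
      using s(1) by (simp add: divide_right_mono)
  qed (intro sum_nonneg g_nonneg)
  finally show ?thesis
    by (simp add: s_def)
qed

section \<open>Supports\<close>

text \<open>For r > R, Markov's inequality for the power 2p bounds the mass where |y| > r by
  (R/r)^(2p), which tends to 0 as p grows.\<close>

lemma measure_support_subset_if_even_moments_le:
  assumes M: "real_distribution M"
    and moments: "\<And>p. p \<ge> 1 \<Longrightarrow> integrable M (\<lambda>x. x ^ (2 * p))"
      "\<And>p. p \<ge> 1 \<Longrightarrow> (\<integral>x. x ^ (2 * p) \<partial>M) \<le> R ^ (2 * p)"
    and R: "0 < R"
  shows "measure_support M \<subseteq> {-R..R}"
proof
  interpret real_distribution M by fact
  fix x assume x: "x \<in> measure_support M"
  show "x \<in> {-R..R}"
  proof (rule ccontr)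
    assume "x \<notin> {-R..R}"
    then have "R < \<bar>x\<bar>"
      by auto
    then obtain r where r: "R < r" "r < \<bar>x\<bar>"
      using dense by blast
    let ?U = "{y. r < \<bar>y\<bar>}"
    have "open ?U"
      by (intro open_Collect_less continuous_intros)
    then have pos: "emeasure M ?U > 0"
      using x r unfolding measure_support_def by blast
    have bound: "measure M ?U \<le> ((R / r)\<^sup>2) ^ p" if "p \<ge> 1" for p
    proof -
      have "measure M ?U \<le> measure M {y \<in> space M. r ^ (2 * p) \<le> y ^ (2 * p)}"
      proof (rule finite_measure_mono)
        show "?U \<subseteq> {y \<in> space M. r ^ (2 * p) \<le> y ^ (2 * p)}"
        proof clarify
          fix y :: real assume "r < \<bar>y\<bar>"
          then have "r ^ (2 * p) \<le> \<bar>y\<bar> ^ (2 * p)"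
            using r R by (intro power_mono) auto
          then show "y \<in> space M \<and> r ^ (2 * p) \<le> y ^ (2 * p)"
            by (simp add: power_even_abs)
        qed
      qed measurable
      also have "\<dots> \<le> (\<integral>y. y ^ (2 * p) \<partial>M) / r ^ (2 * p)"
        using r R moments(1)[OF that]
        by (intro integral_Markov_inequality_measure[where A = "{}"]) auto
      also have "\<dots> \<le> R ^ (2 * p) / r ^ (2 * p)"
        using r R moments(2)[OF that] by (intro divide_right_mono) auto
      finally show ?thesis
        by (simp add: power_mult power_divide)
    qed
    have "(R / r)\<^sup>2 < 1"
      using r R by (simp add: power_less_one_iff abs_square_less_1)
    then have "(\<lambda>p. ((R / r)\<^sup>2) ^ p) \<longlonglongrightarrow> 0"
      by (intro LIMSEQ_realpow_zero) auto
    then have "measure M ?U \<le> 0"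
      by (rule LIMSEQ_le_const) (use bound in blast)
    then show False
      using pos by (simp add: emeasure_eq_measure)
  qed
qed

text \<open>The support bound compares the moments of \<open>\<mu>w\<close> directly with the sum
  over pair partitions, so it does not presuppose that a q-Gaussian measure exists.\<close>

theorem proposition1p2:
  fixes w :: "real \<Rightarrow> real \<Rightarrow> real" and \<mu>w :: "real measure" and q :: real
  assumes "graphon w"
    and "graphon_law w \<mu>w"
    and "q = (SUP z\<in>{0..1} \<times> {0..1}. w (fst z) (snd z))"
  shows "(\<forall>\<mu>q. q_gaussian_law q \<mu>q \<longrightarrow>
            (\<forall>p\<ge>1. (\<integral>x. x ^ p \<partial>\<mu>w) \<le> (\<integral>x. x ^ p \<partial>\<mu>q))) \<and>
    (q < 1 \<longrightarrow>
       bounded (measure_support \<mu>w) \<and>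
       measure_support \<mu>w \<subseteq> {- (2 / sqrt (1 - q)) .. 2 / sqrt (1 - q)})"
proof -
  have w: "0 \<le> w x y" "w x y \<le> 1" if "x \<in> {0..1}" "y \<in> {0..1}" for x y
    using assms(1) that unfolding graphon_def by blast+
  \<comment> \<open>A real \<open>SUP\<close> is an upper bound only of a set that is bounded above;
    here the bound is 1.\<close>
  have "bdd_above ((\<lambda>z. w (fst z) (snd z)) ` ({0..1} \<times> {0..1}))"
    using w(2) by (intro bdd_aboveI[of _ 1]) auto
  then have w_le: "w x y \<le> q" if "x \<in> {0..1}" "y \<in> {0..1}" for x y
    using cSUP_upper[of "(x, y)" "{0..1} \<times> {0..1}" "\<lambda>z. w (fst z) (snd z)"] that assms(3)
    by simp
  have q: "0 \<le> q"
    using w(1)[of 0 0] w_le[of 0 0] by simp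
  have law: "real_distribution \<mu>w" "\<And>n. integrable \<mu>w (\<lambda>x. x ^ n)"
    "\<And>n. odd n \<Longrightarrow> (\<integral>x. x ^ n \<partial>\<mu>w) = 0"
    "\<And>p. p \<ge> 1 \<Longrightarrow> (\<integral>x. x ^ (2 * p) \<partial>\<mu>w) =
      (\<Sum>\<pi>\<in>pair_partitions (2 * p). hom_density \<pi> (intersection_edges \<pi>) w)"
    using assms(2) unfolding graphon_law_def law_with_even_moments_def by blast+
  have moment_le: "(\<integral>x. x ^ (2 * p) \<partial>\<mu>w)
      \<le> (\<Sum>\<pi>\<in>pair_partitions (2 * p). q ^ card (intersection_edges \<pi>))" if "p \<ge> 1" for p
    unfolding law(4)[OF that]
    by (intro sum_mono hom_density_le_power assms(1) w_le q) (auto simp: intersection_edges_def)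
  show ?thesis
  proof (intro conjI allI impI)
    fix \<mu>q :: "real measure" and p :: nat
    assume "q_gaussian_law q \<mu>q" and p: "1 \<le> p"
    then have \<mu>q: "\<And>n. odd n \<Longrightarrow> (\<integral>x. x ^ n \<partial>\<mu>q) = 0"
      "\<And>p. p \<ge> 1 \<Longrightarrow> (\<integral>x. x ^ (2 * p) \<partial>\<mu>q) =
        (\<Sum>\<pi>\<in>pair_partitions (2 * p). q ^ card (intersection_edges \<pi>))"
      unfolding q_gaussian_law_def law_with_even_moments_def by blast+
    show "(\<integral>x. x ^ p \<partial>\<mu>w) \<le> (\<integral>x. x ^ p \<partial>\<mu>q)"
    proof (cases "odd p")
      case False
      then obtain k where "p = 2 * k" by blast
      then show ?thesis
        using p moment_le[of k] \<mu>q(2)[of k] by simp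
    qed (simp add: law(3) \<mu>q(1))
  next
    assume "q < 1"
    show support: "measure_support \<mu>w \<subseteq> {- (2 / sqrt (1 - q)) .. 2 / sqrt (1 - q)}"
    proof (rule measure_support_subset_if_even_moments_le)
      show "(\<integral>x. x ^ (2 * p) \<partial>\<mu>w) \<le> (2 / sqrt (1 - q)) ^ (2 * p)" if "p \<ge> 1" for p
        using moment_le[OF that] sum_power_intersection_edges_le[OF q \<open>q < 1\<close>]
        by (rule order_trans)
    qed (use law \<open>q < 1\<close> in simp_all)
    then show "bounded (measure_support \<mu>w)"
      by (rule bounded_subset[OF bounded_closed_interval])
  qed
qed

end
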